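(* For every object $(X,R)$ of $\mathrm{Endo}(\mathrm{FRel})$ (that is, $X$ a finite set and $R\subset X\times X$ an arbitrary relation) there exists an object $(\bar X,\bar R)$ of $\mathrm{Endo}(\mathrm{FRel})$ in canonical form such that $(X,R)$ and $(\bar X,\bar R)$ are isomorphic in $\mathrm{Szym}(\mathrm{FRel})$.
   Context: $\mathbb N=\{0,1,2,\dots\}$, $\mathbb N_1=\{1,2,\dots\}$. For relations $R\subset X\times Y$, $S\subset Y\times Z$ the composition is $S\circ R=\{(x,z): \exists y\in Y,\ (x,y)\in R,\ (y,z)\in S\}$; for $R\subset X\times X$, $R^0=\mathrm{id}_X$ and $R^n=R\circ R^{n-1}$; for $A\subset X$, $R|_A=R\cap(A\times A)$. Categories. $\mathrm{FRel}$: objects are finite sets, morphisms $X\to X'$ are all relations in $X\times X'$, and the composition of morphisms $R\subset X\times X'$ and $R'\subset X'\times X''$ is the composition of relations $R'\circ R=\{(x,x''): \exists x'\in X',\ (x,x')\in R,\ (x',x'')\in R'\}$. $\mathrm{Endo}(\mathrm{FRel})$: objects are pairs $(X,R)$ with $X$ a finite set and $R\subset X\times X$; morphisms $(X,R)\to(X',R')$ are relations $S\subset X\times X'$ with $S\circ R=R'\circ S$. $\mathrm{Szym}(\mathrm{FRel})$: same objects as $\mathrm{Endo}(\mathrm{FRel})$; morphisms $(X,R)\to(X',R')$ are equivalence classes $[S,m]$ of pairs $(S,m)$, with $S:(X,R)\to(X',R')$ a morphism in $\mathrm{Endo}(\mathrm{FRel})$ and $m\in\mathbb N$, where $(S,m)\equiv(S',m')$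 iff there is $k\in\mathbb N$ with $S\circ R^{m'+k}=S'\circ R^{m+k}$; composition is $[S',m']\circ[S,m]=[S'\circ S,m+m']$ and the identity of $(X,R)$ is $[\mathrm{id}_X,0]$. Recurrence. For $R\subset X\times X$, write $x\leftrightarrow_R y$ if $(x,y)\in R^n$ and $(y,x)\in R^m$ for some $n,m\in\mathbb N_1$. The recurrent set is $X_R=\{x\in X: x\leftrightarrow_R x\}$; $\leftrightarrow_R$ is an equivalence relation on $X_R$ whose classes $[x]_R$ are called the strongly connected components of $R$. An eventual period of $R$ is any $p\in\mathbb N_1$ such that $R^{i+p}=R^i$ for all $i\ge p$ (it always exists for finite $X$). Canonical form. $(X,R)$ is in canonical form (is canonical) if: (i) $X=X_R$; (ii) for each $x\in X$ the restriction $R|_{[x]_R}$ is a bijective map $[x]_R\to[x]_R$; (iii) $R^{n+p}=R^n$ for each $n\in\mathbb N_1$, where $p$ is an eventual period of $R$. *)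

theory Defs
  imports Main
begin

text \<open>
  The composition \<open>S \<circ> R\<close> of FRel (first \<open>R\<close>, then \<open>S\<close>) is \<open>R O S\<close> in the notation of HOL.
  An object \<open>(X, R)\<close> of Endo(FRel) is passed as two arguments. Objects may live over
  different types, so that morphisms are heterogeneous relations; finite subsets of \<open>nat\<close>
  represent all finite sets up to bijection.
\<close>

definition endo_obj :: "'a set \<Rightarrow> 'a rel \<Rightarrow> bool" where
  "endo_obj X R \<longleftrightarrow> finite X \<and> R \<subseteq> X \<times> X"

definition endo_hom :: "'a set \<Rightarrow> 'a rel \<Rightarrow> 'b set \<Rightarrow> 'b rel \<Rightarrow> ('a \<times> 'b) set set" where
  "endo_hom X R X' R' = {S. S \<subseteq> X \<times> X' \<and> R O S = S O R'}"

text \<open>Unlike \<open>R ^^ 0\<close>, the zeroth power is the identity of \<open>X\<close> and not of the whole type.\<close>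

primrec rpow :: "'a set \<Rightarrow> 'a rel \<Rightarrow> nat \<Rightarrow> 'a rel" where
  "rpow X R 0 = Id_on X"
| "rpow X R (Suc n) = rpow X R n O R"

definition szym_equiv ::
  "'a set \<Rightarrow> 'a rel \<Rightarrow> 'b set \<Rightarrow> 'b rel \<Rightarrow> (('a \<times> 'b) set \<times> nat) rel" where
  "szym_equiv X R X' R' = {((S, m), (S', m')).
     S \<in> endo_hom X R X' R' \<and> S' \<in> endo_hom X R X' R' \<and>
     (\<exists>k. rpow X R (m' + k) O S = rpow X R (m + k) O S')}"

definition szym_class ::
  "'a set \<Rightarrow> 'a rel \<Rightarrow> 'b set \<Rightarrow> 'b rel \<Rightarrow> ('a \<times> 'b) set \<Rightarrow> nat \<Rightarrow> (('a \<times> 'b) set \<times> nat) set" where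
  "szym_class X R X' R' S m = szym_equiv X R X' R' `` {(S, m)}"

definition szym_hom ::
  "'a set \<Rightarrow> 'a rel \<Rightarrow> 'b set \<Rightarrow> 'b rel \<Rightarrow> (('a \<times> 'b) set \<times> nat) set set" where
  "szym_hom X R X' R' = (endo_hom X R X' R' \<times> UNIV) // szym_equiv X R X' R'"

text \<open>
  \<open>szym_comp X R X'' R'' F G\<close> is \<open>G \<circ> F\<close>. All representatives of \<open>F\<close> and \<open>G\<close> give
  the same class (lemma \<open>szym_comp_class\<close> below), so the union is that class.
\<close>

definition szym_comp ::
  "'a set \<Rightarrow> 'a rel \<Rightarrow> 'c set \<Rightarrow> 'c rel \<Rightarrow>
   (('a \<times> 'b) set \<times> nat) set \<Rightarrow> (('b \<times> 'c) set \<times> nat) set \<Rightarrow> (('a \<times> 'c) set \<times> nat) set" where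
  "szym_comp X R X'' R'' F G =
     (\<Union>(S, m)\<in>F. \<Union>(S', m')\<in>G. szym_class X R X'' R'' (S O S') (m + m'))"

definition szym_id :: "'a set \<Rightarrow> 'a rel \<Rightarrow> ('a rel \<times> nat) set" where
  "szym_id X R = szym_class X R X R (Id_on X) 0"

definition szym_isomorphic :: "'a set \<Rightarrow> 'a rel \<Rightarrow> 'b set \<Rightarrow> 'b rel \<Rightarrow> bool" where
  "szym_isomorphic X R X' R' \<longleftrightarrow>
     (\<exists>F \<in> szym_hom X R X' R'. \<exists>G \<in> szym_hom X' R' X R.
        szym_comp X R X R F G = szym_id X R \<and> szym_comp X' R' X' R' G F = szym_id X' R')"

definition mutually_reachable :: "'a set \<Rightarrow> 'a rel \<Rightarrow> 'a \<Rightarrow> 'a \<Rightarrow> bool" where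
  "mutually_reachable X R x y \<longleftrightarrow>
     (\<exists>n\<ge>1. \<exists>m\<ge>1. (x, y) \<in> rpow X R n \<and> (y, x) \<in> rpow X R m)"

definition recurrent_set :: "'a set \<Rightarrow> 'a rel \<Rightarrow> 'a set" where
  "recurrent_set X R = {x \<in> X. mutually_reachable X R x x}"

definition scc :: "'a set \<Rightarrow> 'a rel \<Rightarrow> 'a \<Rightarrow> 'a set" where
  "scc X R x = {y \<in> recurrent_set X R. mutually_reachable X R x y}"

definition eventual_period :: "'a set \<Rightarrow> 'a rel \<Rightarrow> nat \<Rightarrow> bool" where
  "eventual_period X R p \<longleftrightarrow> p \<ge> 1 \<and> (\<forall>i\<ge>p. rpow X R (i + p) = rpow X R i)"

text \<open>
  The last conjunct holds for one eventual period if and only if it holds for all of them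
  (lemma \<open>periodic_eventual_period\<close> below).
\<close>

definition canonical :: "'a set \<Rightarrow> 'a rel \<Rightarrow> bool" where
  "canonical X R \<longleftrightarrow>
     X = recurrent_set X R \<and>
     (\<forall>x\<in>X. \<exists>f. bij_betw f (scc X R x) (scc X R x) \<and>
        R \<inter> (scc X R x \<times> scc X R x) = {(y, f y) | y. y \<in> scc X R x}) \<and>
     (\<exists>p. eventual_period X R p \<and> (\<forall>n\<ge>1. rpow X R (n + p) = rpow X R n))"

lemma rpow_add: "R \<subseteq> X \<times> X \<Longrightarrow> rpow X R (m + n) = rpow X R m O rpow X R n"
proof (induction n)
  case 0
  have "rpow X R m \<subseteq> X \<times> X" using 0 by (induction m) auto
  then show ?case by auto
next
  case (Suc n)
  then show ?case by (simp add: O_assoc)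
qed

lemma endo_hom_rpow:
  assumes "S \<in> endo_hom X R X' R'"
  shows "rpow X R n O S = S O rpow X' R' n"
proof (induction n)
  case 0
  show ?case using assms by (auto simp: endo_hom_def)
next
  case (Suc n)
  have "R O S = S O R'" using assms by (simp add: endo_hom_def)
  then show ?case by (metis O_assoc Suc.IH rpow.simps(2))
qed

lemma endo_hom_comp:
  assumes "S \<in> endo_hom X R X' R'" "S' \<in> endo_hom X' R' X'' R''"
  shows "S O S' \<in> endo_hom X R X'' R''"
proof -
  have "R O S = S O R'" "R' O S' = S' O R''" using assms by (auto simp: endo_hom_def)
  then have "R O (S O S') = (S O S') O R''" by (metis O_assoc)
  moreover have "S O S' \<subseteq> X \<times> X''" using assms by (auto simp: endo_hom_def)
  ultimately show ?thesis by (simp add: endo_hom_def)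
qed

lemma equiv_szym_equiv:
  assumes R: "R \<subseteq> X \<times> X"
  shows "equiv (endo_hom X R X' R' \<times> UNIV) (szym_equiv X R X' R')"
proof (rule equivI)
  show "szym_equiv X R X' R' \<subseteq> (endo_hom X R X' R' \<times> UNIV) \<times> (endo_hom X R X' R' \<times> UNIV)"
    by (auto simp: szym_equiv_def)
  show "refl_on (endo_hom X R X' R' \<times> UNIV) (szym_equiv X R X' R')"
    by (auto simp: refl_on_def szym_equiv_def)
  show "sym (szym_equiv X R X' R')"
    unfolding sym_def szym_equiv_def by (auto, metis)
  show "trans (szym_equiv X R X' R')"
  proof (rule transI)
    fix a b c
    assume ab: "(a, b) \<in> szym_equiv X R X' R'" and bc: "(b, c) \<in> szym_equiv X R X' R'"
    obtain S m S' m' S'' m'' where abc: "a = (S, m)" "b = (S', m')" "c = (S'', m'')"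
      by (metis surj_pair)
    from ab bc obtain k l where
      k: "rpow X R (m' + k) O S = rpow X R (m + k) O S'" and
      l: "rpow X R (m'' + l) O S' = rpow X R (m' + l) O S''"
      by (auto simp: szym_equiv_def abc)
    have "rpow X R (m'' + (m' + k + l)) O S = rpow X R ((m'' + l) + (m' + k)) O S"
      by (simp add: ac_simps)
    also have "\<dots> = rpow X R (m'' + l) O (rpow X R (m + k) O S')"
      by (simp only: rpow_add[OF R, of "m'' + l"] O_assoc k)
    also have "\<dots> = rpow X R ((m + k) + (m'' + l)) O S'"
      by (simp only: O_assoc[symmetric] rpow_add[OF R, symmetric] add.commute)
    also have "\<dots> = rpow X R (m + k) O (rpow X R (m' + l) O S'')"
      by (simp only: rpow_add[OF R, of "m + k"] O_assoc l)
    also have "\<dots> = rpow X R (m + (m' + k + l)) O S''"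
      by (simp only: O_assoc[symmetric] rpow_add[OF R, symmetric] ac_simps)
    finally show "(a, c) \<in> szym_equiv X R X' R'"
      using ab bc by (auto simp: szym_equiv_def abc)
  qed
qed

lemma szym_equiv_comp:
  assumes R: "R \<subseteq> X \<times> X" and R': "R' \<subseteq> X' \<times> X'"
    and S: "((S, m), (T, n)) \<in> szym_equiv X R X' R'"
    and S': "((S', m'), (T', n')) \<in> szym_equiv X' R' X'' R''"
  shows "((S O S', m + m'), (T O T', n + n')) \<in> szym_equiv X R X'' R''"
proof -
  from S S' obtain k l where
    k: "rpow X R (n + k) O S = rpow X R (m + k) O T" and
    l: "rpow X' R' (n' + l) O S' = rpow X' R' (m' + l) O T'"
    by (auto simp: szym_equiv_def)
  have hom: "S \<in> endo_hom X R X' R'" "T \<in> endo_hom X R X' R'"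
    "S' \<in> endo_hom X' R' X'' R''" "T' \<in> endo_hom X' R' X'' R''"
    using S S' by (auto simp: szym_equiv_def)
  have "rpow X R ((n + n') + (k + l)) O (S O S') = rpow X R ((n' + l) + (n + k)) O (S O S')"
    by (simp add: ac_simps)
  also have "\<dots> = rpow X R (n' + l) O ((rpow X R (n + k) O S) O S')"
    by (simp only: rpow_add[OF R, of "n' + l"] O_assoc)
  also have "\<dots> = (rpow X R (n' + l) O rpow X R (m + k)) O (T O S')"
    by (simp only: k O_assoc)
  also have "\<dots> = (rpow X R (m + k) O rpow X R (n' + l)) O (T O S')"
    by (simp only: rpow_add[OF R, symmetric] add.commute)
  also have "\<dots> = rpow X R (m + k) O (rpow X R (n' + l) O T) O S'"
    by (simp only: O_assoc)
  also have "\<dots> = rpow X R (m + k) O T O rpow X' R' (n' + l) O S'"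
    by (simp only: endo_hom_rpow[OF hom(2)] O_assoc)
  also have "\<dots> = rpow X R (m + k) O (T O rpow X' R' (m' + l)) O T'"
    by (simp only: l O_assoc)
  also have "\<dots> = (rpow X R (m + k) O rpow X R (m' + l)) O (T O T')"
    by (simp only: endo_hom_rpow[OF hom(2), symmetric] O_assoc)
  also have "\<dots> = rpow X R ((m + m') + (k + l)) O (T O T')"
    by (simp only: rpow_add[OF R, symmetric] ac_simps)
  finally have "\<exists>j. rpow X R ((n + n') + j) O (S O S') = rpow X R ((m + m') + j) O (T O T')" ..
  then show ?thesis
    using endo_hom_comp[OF hom(1,3)] endo_hom_comp[OF hom(2,4)] by (simp add: szym_equiv_def)
qed

lemma szym_comp_class:
  assumes R: "R \<subseteq> X \<times> X" and R': "R' \<subseteq> X' \<times> X'"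
    and S: "S \<in> endo_hom X R X' R'" and S': "S' \<in> endo_hom X' R' X'' R''"
  shows "szym_comp X R X'' R'' (szym_class X R X' R' S m) (szym_class X' R' X'' R'' S' m') =
    szym_class X R X'' R'' (S O S') (m + m')"
proof -
  have eq: "szym_class X R X'' R'' (T O T') (n + n') = szym_class X R X'' R'' (S O S') (m + m')"
    if "(T, n) \<in> szym_class X R X' R' S m" "(T', n') \<in> szym_class X' R' X'' R'' S' m'"
    for T n T' n'
    using szym_equiv_comp[OF R R'] that
      equiv_class_eq[OF equiv_szym_equiv[OF R]]
    unfolding szym_class_def by (metis Image_singleton_iff)
  have mem: "(S, m) \<in> szym_class X R X' R' S m" "(S', m') \<in> szym_class X' R' X'' R'' S' m'"
    using S S' by (auto simp: szym_class_def szym_equiv_def)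
  show ?thesis (is "?L = ?C")
  proof
    show "?L \<subseteq> ?C"
      unfolding szym_comp_def by (intro UN_least) (auto simp: eq)
    show "?C \<subseteq> ?L"
      unfolding szym_comp_def using mem by blast
  qed
qed

lemma periodic_eventual_period:
  assumes R: "R \<subseteq> X \<times> X"
    and p: "eventual_period X R p" and q: "eventual_period X R q"
    and per: "\<forall>n\<ge>1. rpow X R (n + p) = rpow X R n" and n: "n \<ge> 1"
  shows "rpow X R (n + q) = rpow X R n"
proof -
  have mult: "rpow X R (i + k * p) = rpow X R i" if "i \<ge> 1" for i k
  proof (induction k)
    case (Suc k)
    have "rpow X R (i + Suc k * p) = rpow X R ((i + k * p) + p)" by (simp add: ac_simps)
    also have "\<dots> = rpow X R (i + k * p)" using per that by (metis trans_le_add1)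
    finally show ?case using Suc.IH by simp
  qed simp
  have "p \<ge> 1" using p by (simp add: eventual_period_def)
  then have ge: "n + q * p \<ge> q" by (cases p) auto
  have "rpow X R (n + q) = rpow X R ((n + q) + q * p)" using mult[of "n + q" q] n by simp
  also have "\<dots> = rpow X R ((n + q * p) + q)" by (simp add: ac_simps)
  also have "\<dots> = rpow X R (n + q * p)" using q ge by (simp add: eventual_period_def)
  also have "\<dots> = rpow X R n" using mult n by simp
  finally show ?thesis .
qed

end

theory Submission
  imports Defs
begin

text \<open>
  For a suitable \<open>p \<ge> 1\<close> the power \<open>E = R\<^sup>p\<close> is idempotent. On the set \<open>Z\<close> of its fixed
  points \<open>E\<close> is a preorder, and since \<open>X\<close> is finite, any two points related by \<open>E\<close> are
  related through a point of \<open>Z\<close>. Hence \<open>E\<close> splits as \<open>T \<circ> S\<close> through the quotient poset \<open>Y\<close>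
  of \<open>Z\<close>, with \<open>S \<circ> T\<close> the partial order of \<open>Y\<close>. Put \<open>Q = S \<circ> R \<circ> T\<close>. Then
  \<open>Q\<^sup>n = S \<circ> R\<^sup>n \<circ> T\<close> for \<open>n \<ge> 1\<close>, so \<open>[S, 0]\<close> and \<open>[T, p]\<close> are mutually inverse. Since
  \<open>Q\<^sup>p\<close> is a partial order, the map condition holds: two successors of a point inside its
  component are related by \<open>Q\<^sup>p\<close> in both directions, hence equal.
\<close>

section \<open>Powers of a relation on a finite set\<close>

lemma rpow_subset: "R \<subseteq> X \<times> X \<Longrightarrow> rpow X R n \<subseteq> X \<times> X"
  by (induction n) auto

lemma rpow_1: "R \<subseteq> X \<times> X \<Longrightarrow> rpow X R (Suc 0) = R"
  by auto

lemma self_endo_hom: "R \<subseteq> X \<times> X \<Longrightarrow> R \<in> endo_hom X R X R"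
  by (simp add: endo_hom_def)

lemma rpow_endo_hom:
  assumes "R \<subseteq> X \<times> X"
  shows "rpow X R n \<in> endo_hom X R X R"
  using rpow_subset[OF assms] endo_hom_rpow[OF self_endo_hom[OF assms], of n]
  by (simp add: endo_hom_def)

lemma rpow_mult_period:
  assumes per: "\<And>n. n \<ge> 1 \<Longrightarrow> rpow X R (n + p) = rpow X R n"
    and "k \<ge> 1" "p \<ge> 1"
  shows "rpow X R (k * p) = rpow X R p"
  using \<open>k \<ge> 1\<close>
proof (induction k rule: dec_induct)
  case (step k)
  have "k * p \<ge> 1" using step(1) \<open>p \<ge> 1\<close> by simp
  then show ?case using per[of "k * p"] step.IH by (simp add: add.commute)
qed simp

lemma rpow_mult_refl:
  assumes R: "R \<subseteq> X \<times> X" and "x \<in> X" "(x, x) \<in> rpow X R n"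
  shows "(x, x) \<in> rpow X R (n * k)"
proof (induction k)
  case (Suc k)
  then show ?case using rpow_add[OF R, of "n * k" n] assms by (auto simp: add.commute)
qed (use assms in auto)

text \<open>By the pigeonhole principle two powers coincide, so the powers are
  \<open>d\<close>-periodic from some exponent \<open>i\<close> on. Any positive multiple of
  \<open>d\<close> that is at least \<open>i\<close> then serves as \<open>p\<close>.\<close>

lemma ex_idempotent_rpow:
  assumes "finite X" and R: "R \<subseteq> X \<times> X"
  shows "\<exists>p\<ge>1. rpow X R (p + p) = rpow X R p"
proof -
  have "range (rpow X R) \<subseteq> Pow (X \<times> X)" using rpow_subset[OF R] by blast
  then have "finite (range (rpow X R))"
    by (rule finite_subset) (simp add: assms)
  then have "\<not> inj (rpow X R)"
    using finite_imageD infinite_UNIV_nat by blast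
  then obtain i j where "i < j" "rpow X R i = rpow X R j"
    unfolding inj_def by (metis linorder_neqE_nat)
  then obtain d where d: "d \<ge> 1" "rpow X R (i + d) = rpow X R i"
    by (metis less_imp_add_positive Suc_leI One_nat_def)
  have shift: "rpow X R (n + d) = rpow X R n" if "n \<ge> i" for n
  proof -
    have "rpow X R (n + d) = rpow X R (i + d) O rpow X R (n - i)"
      using that by (simp add: rpow_add[OF R, symmetric] add.commute)
    also have "\<dots> = rpow X R n"
      using that d by (simp add: rpow_add[OF R, symmetric])
    finally show ?thesis .
  qed
  have mult: "rpow X R (n + k * d) = rpow X R n" if "n \<ge> i" for n k
  proof (induction k)
    case (Suc k)
    have "rpow X R ((n + k * d) + d) = rpow X R (n + k * d)" by (rule shift) (use that in simp)
    then show ?case using Suc by (simp add: ac_simps)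
  qed simp
  \<comment> \<open>The factor \<open>Suc i\<close> rather than \<open>i\<close> keeps the exponent
    positive when \<open>i = 0\<close>.\<close>
  have le: "i \<le> Suc i * d" using d by (cases d) auto
  have "rpow X R (Suc i * d + Suc i * d) = rpow X R (Suc i * d)"
    by (rule mult[OF le])
  moreover have "Suc i * d \<ge> 1" using d by simp
  ultimately show ?thesis by blast
qed

section \<open>Splitting an idempotent relation through a finite poset\<close>

text \<open>Without a fixed point among the points between \<open>x\<close> and \<open>y\<close>,
  \<open>E\<close> would be a strict order on this finite set and have a minimal element
  \<open>z\<close> there. Idempotence inserts a further point \<open>w\<close> between
  \<open>x\<close> and \<open>z\<close>, contradicting minimality.\<close>

lemma idempotent_fixpoint_between:
  assumes "finite X" "E \<subseteq> X \<times> X" and idem: "E O E = E" and "(x, y) \<in> E"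
  shows "\<exists>z. (x, z) \<in> E \<and> (z, z) \<in> E \<and> (z, y) \<in> E"
proof (rule ccontr)
  assume none: "\<not> ?thesis"
  define A where "A = {z. (x, z) \<in> E \<and> (z, y) \<in> E}"
  have tr: "trans E" using idem by (auto intro: transI)
  have "A \<subseteq> X" using assms by (auto simp: A_def)
  then have "finite (E \<inter> A \<times> A)" using \<open>finite X\<close> by (meson finite_Int finite_SigmaI finite_subset)
  moreover have "trans (E \<inter> A \<times> A)" using tr by (auto intro!: transI dest: transD)
  then have "acyclic (E \<inter> A \<times> A)"
    using none by (auto simp: acyclic_irrefl irrefl_def A_def)
  ultimately have wf: "wf (E \<inter> A \<times> A)" by (rule finite_acyclic_wf)
  obtain z0 where "z0 \<in> A" using \<open>(x, y) \<in> E\<close> idem unfolding A_def by blast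
  then obtain z where z: "z \<in> A" "\<And>w. (w, z) \<in> E \<inter> A \<times> A \<Longrightarrow> w \<notin> A"
    using wfE_min[OF wf] by metis
  obtain w where "(x, w) \<in> E" "(w, z) \<in> E" using z(1) idem unfolding A_def by blast
  moreover have "(w, y) \<in> E" using tr calculation z(1) by (auto simp: A_def dest: transD)
  ultimately show False using z by (auto simp: A_def)
qed

lemma idempotent_splits_through_poset:
  assumes fin: "finite X" and E: "E \<subseteq> X \<times> X" and idem: "E O E = E"
  obtains Y :: "nat set" and S T where
    "finite Y" "S \<subseteq> X \<times> Y" "T \<subseteq> Y \<times> X"
    "S O T = E" "E O S = S" "T O E = T" "refl_on Y (T O S)" "antisym (T O S)"
proof -
  have tr: "(x, z) \<in> E" if "(x, y) \<in> E" "(y, z) \<in> E" for x y z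
    using that idem by blast
  define Z where "Z = {x. (x, x) \<in> E}"
  define cl where "cl z = {y. (z, y) \<in> E \<and> (y, z) \<in> E}" for z
  have "Z \<subseteq> X" using E by (auto simp: Z_def)
  then have finZ: "finite Z" using fin finite_subset by blast
  \<comment> \<open>Numbering the equivalence classes by \<open>h\<close> realises the quotient of
    \<open>Z\<close> as a set of naturals.\<close>
  then obtain h :: "'a set \<Rightarrow> nat" where h: "inj_on h (cl ` Z)"
    using finite_imp_inj_to_nat_seg[of "cl ` Z"] by blast
  define g where "g z = h (cl z)" for z
  have g: "g z = g w \<longleftrightarrow> (z, w) \<in> E \<and> (w, z) \<in> E" if "z \<in> Z" "w \<in> Z" for z w
  proof
    assume "g z = g w"
    then have "cl z = cl w" using h that by (auto simp: g_def inj_on_def)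
    moreover have "z \<in> cl z" using that by (auto simp: cl_def Z_def)
    ultimately show "(z, w) \<in> E \<and> (w, z) \<in> E" by (auto simp: cl_def)
  next
    assume "(z, w) \<in> E \<and> (w, z) \<in> E"
    then have "cl z = cl w" by (auto simp: cl_def intro: tr)
    then show "g z = g w" by (simp add: g_def)
  qed
  define S where "S = {(x, g z) | x z. z \<in> Z \<and> (x, z) \<in> E}"
  define T where "T = {(g z, x) | x z. z \<in> Z \<and> (z, x) \<in> E}"
  have TS: "T O S = {(g z, g w) | z w. z \<in> Z \<and> w \<in> Z \<and> (z, w) \<in> E}"
  proof
    show "T O S \<subseteq> {(g z, g w) | z w. z \<in> Z \<and> w \<in> Z \<and> (z, w) \<in> E}"
      unfolding S_def T_def by clarify (metis tr)
    show "{(g z, g w) | z w. z \<in> Z \<and> w \<in> Z \<and> (z, w) \<in> E} \<subseteq> T O S"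
      unfolding S_def T_def Z_def by blast
  qed
  show thesis
  proof
    show "finite (g ` Z)" using finZ by simp
    show "S \<subseteq> X \<times> g ` Z" "T \<subseteq> g ` Z \<times> X" using E by (auto simp: S_def T_def)
    show "S O T = E"
    proof
      show "S O T \<subseteq> E" by (auto simp: S_def T_def g) (meson tr)
      show "E \<subseteq> S O T"
      proof
        fix e assume "e \<in> E"
        moreover obtain x y where "e = (x, y)" by fastforce
        ultimately obtain z where "(x, z) \<in> E" "z \<in> Z" "(z, y) \<in> E"
          using idempotent_fixpoint_between[OF fin E idem, of x y] by (auto simp: Z_def)
        then show "e \<in> S O T" unfolding S_def T_def \<open>e = (x, y)\<close> by blast
      qed
    qed
    show "E O S = S"
      unfolding S_def Z_def by (auto intro: tr)
    show "T O E = T"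
      unfolding T_def Z_def by (auto intro: tr)
    show "refl_on (g ` Z) (T O S)" by (auto simp: TS refl_on_def Z_def)
    show "antisym (T O S)"
    proof (rule antisymI)
      fix a b assume "(a, b) \<in> T O S" "(b, a) \<in> T O S"
      then obtain z w w' z' where *: "z \<in> Z" "w \<in> Z" "w' \<in> Z" "z' \<in> Z"
        "a = g z" "b = g w" "b = g w'" "a = g z'" "(z, w) \<in> E" "(w', z') \<in> E"
        unfolding TS by blast
      \<comment> \<open>The representatives of \<open>a\<close> and \<open>b\<close> may differ in
        the two pairs. Linking them within their classes closes the cycle \<open>z\<close>,
        \<open>w\<close>, \<open>w'\<close>, \<open>z'\<close>, \<open>z\<close>.\<close>
      then have "(w, w') \<in> E" "(z', z) \<in> E" using g by metis+
      then have "(w, z) \<in> E" using * by (meson tr)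
      then show "a = b" using * g by blast
    qed
  qed
qed

section \<open>Isomorphisms in Szym(FRel)\<close>

text \<open>The second component acts as a formal inverse of powers:
  \<open>[R^p, p] = [id, 0]\<close>, already with \<open>k = 0\<close> in the equivalence. Hence
  \<open>[S, 0]\<close> and \<open>[T, p]\<close> are mutually inverse.\<close>

lemma szym_isomorphicI:
  assumes R: "R \<subseteq> X \<times> X" and Q: "Q \<subseteq> Y \<times> Y"
    and S: "S \<in> endo_hom X R Y Q" and T: "T \<in> endo_hom Y Q X R"
    and ST: "S O T = rpow X R p" and TS: "T O S = rpow Y Q p"
  shows "szym_isomorphic X R Y Q"
proof -
  have power_id: "szym_class A P A P (rpow A P p) p = szym_id A P"
    if P: "P \<subseteq> A \<times> A" for A :: "'c set" and P
  proof -
    have "Id_on A \<in> endo_hom A P A P" using rpow_endo_hom[OF P, of 0] by simp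
    moreover have "rpow A P (0 + 0) O rpow A P p = rpow A P (p + 0) O Id_on A"
      using rpow_add[OF P, of 0 p] rpow_add[OF P, of p 0] by simp
    ultimately have "((rpow A P p, p), (Id_on A, 0)) \<in> szym_equiv A P A P"
      using rpow_endo_hom[OF P] unfolding szym_equiv_def by blast
    then show ?thesis
      unfolding szym_id_def szym_class_def by (rule equiv_class_eq[OF equiv_szym_equiv[OF P]])
  qed
  let ?F = "szym_class X R Y Q S 0" and ?G = "szym_class Y Q X R T p"
  have "?F \<in> szym_hom X R Y Q" "?G \<in> szym_hom Y Q X R"
    using S T by (auto simp: szym_hom_def szym_class_def intro!: quotientI)
  moreover have "szym_comp X R X R ?F ?G = szym_id X R"
    using szym_comp_class[OF R Q S T, of 0 p] power_id[OF R] ST by simp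
  moreover have "szym_comp Y Q Y Q ?G ?F = szym_id Y Q"
    using szym_comp_class[OF Q R T S, of p 0] power_id[OF Q] TS by simp
  ultimately show ?thesis unfolding szym_isomorphic_def by blast
qed

section \<open>Recognising the canonical form\<close>

lemma mutually_reachable_trans:
  assumes R: "R \<subseteq> X \<times> X"
    and "mutually_reachable X R x y" "mutually_reachable X R y z"
  shows "mutually_reachable X R x z"
proof -
  obtain n m n' m' where "n \<ge> 1" "m \<ge> 1"
    "(x, y) \<in> rpow X R n" "(y, x) \<in> rpow X R m"
    "(y, z) \<in> rpow X R n'" "(z, y) \<in> rpow X R m'"
    using assms(2,3) unfolding mutually_reachable_def by blast
  moreover from this have "(x, z) \<in> rpow X R (n + n')" "(z, x) \<in> rpow X R (m' + m)"
    using rpow_add[OF R] by blast+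
  ultimately show ?thesis unfolding mutually_reachable_def
    by (metis trans_le_add1 trans_le_add2)
qed

lemma mutually_reachable_sym:
  "mutually_reachable X R x y \<Longrightarrow> mutually_reachable X R y x"
  unfolding mutually_reachable_def by blast

text \<open>Any edge inside a component extends to a cycle whose length is a multiple of
  \<open>p\<close>, and such powers equal the \<open>p\<close>-th one. Antisymmetry then forbids
  branching and merging inside a component, while reflexivity supplies successors.\<close>

lemma canonicalI:
  assumes fin: "finite X" and R: "R \<subseteq> X \<times> X" and p: "p \<ge> 1"
    and per: "\<And>n. n \<ge> 1 \<Longrightarrow> rpow X R (n + p) = rpow X R n"
    and reflexive: "refl_on X (rpow X R p)" and anti: "antisym (rpow X R p)"
  shows "canonical X R"
proof -
  have recurrent: "recurrent_set X R = X"
    using reflexive p by (auto simp: recurrent_set_def mutually_reachable_def refl_on_def)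
  have return: "\<exists>k\<ge>1. (y, x) \<in> rpow X R (k * p - 1)"
    if xy: "(x, y) \<in> R" "mutually_reachable X R x y" for x y
  proof -
    obtain m where m: "m \<ge> 1" "(y, x) \<in> rpow X R m"
      using xy unfolding mutually_reachable_def by blast
    \<comment> \<open>After returning from \<open>y\<close> to \<open>x\<close> in \<open>m\<close>
      steps, the cycle of length \<open>m + 1\<close> is run \<open>p - 1\<close> more times. One
      step is missing from \<open>m + 1\<close> full multiples of \<open>p\<close>, so
      \<open>k = m + 1\<close>.\<close>
    have "(x, x) \<in> rpow X R (Suc 0 + m)"
      unfolding rpow_add[OF R] rpow_1[OF R] using xy m by blast
    then have "(x, x) \<in> rpow X R ((Suc 0 + m) * (p - 1))"
      using rpow_mult_refl[OF R] xy R by blast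
    then have "(y, x) \<in> rpow X R (m + (Suc 0 + m) * (p - 1))"
      unfolding rpow_add[OF R, of m] using m by blast
    moreover have "m + (Suc 0 + m) * (p - 1) = Suc m * p - 1"
      using p by (cases p) auto
    ultimately show ?thesis by (metis le_add1 plus_1_eq_Suc)
  qed
  have closed: "rpow X R (k * p - 1) O R = rpow X R p" "R O rpow X R (k * p - 1) = rpow X R p"
    if "k \<ge> 1" for k
  proof -
    have kp: "k * p \<ge> 1" using p that by simp
    have "rpow X R (k * p) = rpow X R p"
      by (rule rpow_mult_period[OF per]) (use p that in auto)
    moreover have "rpow X R (k * p - 1) O R = rpow X R (k * p)"
      using kp by (metis rpow.simps(2) Suc_diff_1 less_le_trans zero_less_one)
    moreover have "R O rpow X R (k * p - 1) = rpow X R (k * p - 1) O R"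
      using rpow_endo_hom[OF R] by (auto simp: endo_hom_def)
    ultimately show "rpow X R (k * p - 1) O R = rpow X R p" "R O rpow X R (k * p - 1) = rpow X R p"
      by auto
  qed
  have right_unique: "y = y'"
    if "(x, y) \<in> R" "(x, y') \<in> R" "mutually_reachable X R x y" "mutually_reachable X R x y'"
    for x y y'
  proof (rule antisymD[OF anti])
    show "(y, y') \<in> rpow X R p" using return[OF that(1,3)] closed(1) that(2) by blast
    show "(y', y) \<in> rpow X R p" using return[OF that(2,4)] closed(1) that(1) by blast
  qed
  have left_unique: "x = x'"
    if "(x, y) \<in> R" "(x', y) \<in> R" "mutually_reachable X R x y" "mutually_reachable X R x' y"
    for x x' y
  proof (rule antisymD[OF anti])
    show "(x, x') \<in> rpow X R p" using return[OF that(2,4)] closed(2) that(1) by blast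
    show "(x', x) \<in> rpow X R p" using return[OF that(1,3)] closed(2) that(2) by blast
  qed
  have successor: "\<exists>y. (x, y) \<in> R \<and> mutually_reachable X R x y" if "x \<in> X" for x
  proof -
    have "(x, x) \<in> rpow X R p" using reflexive that by (simp add: refl_on_def)
    \<comment> \<open>Doubling the loop leaves a return path of length \<open>2 * p - 1\<close>,
      which is positive even when \<open>p = 1\<close>, as mutual reachability demands.\<close>
    then have "(x, x) \<in> rpow X R (p + p)" using per p by blast
    moreover have "p + p = Suc 0 + (2 * p - 1)" using p by simp
    ultimately have "(x, x) \<in> R O rpow X R (2 * p - 1)"
      by (metis rpow_add[OF R] rpow_1[OF R])
    then obtain y where "(x, y) \<in> rpow X R 1" "(y, x) \<in> rpow X R (2 * p - 1)"
      using rpow_1[OF R] by auto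
    moreover have "2 * p - 1 \<ge> 1" using p by simp
    ultimately show ?thesis
      using rpow_1[OF R] unfolding mutually_reachable_def One_nat_def by blast
  qed
  have "\<exists>f. bij_betw f (scc X R x) (scc X R x) \<and>
      R \<inter> (scc X R x \<times> scc X R x) = {(y, f y) | y. y \<in> scc X R x}" for x
  proof -
    let ?C = "scc X R x"
    have C: "y \<in> ?C \<longleftrightarrow> y \<in> X \<and> mutually_reachable X R x y" for y
      by (simp add: scc_def recurrent)
    have conn: "mutually_reachable X R y z" if "y \<in> ?C" "z \<in> ?C" for y z
      using that C mutually_reachable_sym mutually_reachable_trans[OF R] by metis
    obtain f where f: "\<And>y. y \<in> X \<Longrightarrow> (y, f y) \<in> R \<and> mutually_reachable X R y (f y)"
      using successor by metis
    have fC: "f y \<in> ?C" if "y \<in> ?C" for y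
    proof -
      have "mutually_reachable X R x (f y)"
        using f that C mutually_reachable_trans[OF R] by metis
      then show ?thesis using f that C R by blast
    qed
    \<comment> \<open>On a finite component, an injective self-map is bijective.\<close>
    have "inj_on f ?C"
      using left_unique f C by (metis inj_onI)
    moreover have "finite ?C" using fin C by (auto intro: finite_subset)
    ultimately have "bij_betw f ?C ?C"
      using fC by (simp add: bij_betw_def endo_inj_surj image_subset_iff)
    moreover have "R \<inter> (?C \<times> ?C) = {(y, f y) | y. y \<in> ?C}"
      using f fC C conn right_unique by blast
    ultimately show ?thesis by blast
  qed
  moreover have "eventual_period X R p"
    using p per by (auto simp: eventual_period_def)
  ultimately show ?thesis
    using per recurrent unfolding canonical_def by blast
qed

theorem theorem2p1:
  fixes X :: "'a set" and R :: "'a rel"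
  assumes "endo_obj X R"
  shows "\<exists>(Y :: nat set) (Q :: nat rel).
    endo_obj Y Q \<and> canonical Y Q \<and> szym_isomorphic X R Y Q"
proof -
  have fin: "finite X" and R: "R \<subseteq> X \<times> X" using assms by (auto simp: endo_obj_def)
  obtain p where p: "p \<ge> 1" and pp: "rpow X R (p + p) = rpow X R p"
    using ex_idempotent_rpow[OF fin R] by blast
  define E where "E = rpow X R p"
  have EX: "E \<subseteq> X \<times> X" unfolding E_def by (rule rpow_subset[OF R])
  have EE: "E O E = E" using pp rpow_add[OF R, of p p] by (simp add: E_def)
  have RE: "R O E = E O R" using rpow_endo_hom[OF R, of p] by (simp add: endo_hom_def E_def)
  obtain Y :: "nat set" and S T where finY: "finite Y" and S: "S \<subseteq> X \<times> Y" and T: "T \<subseteq> Y \<times> X"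
    and ST: "S O T = E" and ES: "E O S = S" and TE: "T O E = T"
    and reflexive: "refl_on Y (T O S)" and anti: "antisym (T O S)"
    by (rule idempotent_splits_through_poset[OF fin EX EE])
  define Q where "Q = T O R O S"
  have Q: "Q \<subseteq> Y \<times> Y" using S T by (auto simp: Q_def)
  have homS: "S \<in> endo_hom X R Y Q"
  proof -
    \<comment> \<open>The factor \<open>S O T\<close> is \<open>E\<close>, which commutes with
      \<open>R\<close> and is then absorbed by \<open>S\<close>.\<close>
    have "S O Q = (S O T) O R O S" by (simp add: Q_def O_assoc)
    also have "\<dots> = R O S" by (metis ST RE ES O_assoc)
    finally show ?thesis using S by (simp add: endo_hom_def)
  qed
  have homT: "T \<in> endo_hom Y Q X R"
  proof -
    have "Q O T = T O R O (S O T)" by (simp add: Q_def O_assoc)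
    also have "\<dots> = T O R" by (metis ST RE TE O_assoc)
    finally show ?thesis using T by (simp add: endo_hom_def)
  qed
  \<comment> \<open>Exponent \<open>0\<close> is excluded: there the right side is the order
    \<open>T O S\<close>, in general larger than the identity of \<open>Y\<close>.\<close>
  have Qpow: "rpow Y Q n = T O rpow X R n O S" if "n \<ge> 1" for n
    using that
  proof (induction n rule: dec_induct)
    case base
    show ?case by (simp only: One_nat_def rpow_1[OF Q] rpow_1[OF R]) (simp add: Q_def)
  next
    case (step n)
    have "rpow Y Q (Suc n) = T O rpow X R n O (S O Q)" by (simp add: step O_assoc)
    also have "S O Q = R O S" using homS by (simp add: endo_hom_def)
    finally show ?case by (simp add: O_assoc)
  qed
  have Qp: "rpow Y Q p = T O S"
    using Qpow[OF p] ES by (simp add: E_def)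
  \<comment> \<open>Since \<open>S\<close> absorbs \<open>E\<close>, the extra \<open>p\<close>
    steps vanish for every positive \<open>n\<close>, so periodicity starts at the first power and
    not only eventually.\<close>
  have per: "rpow Y Q (n + p) = rpow Y Q n" if "n \<ge> 1" for n
  proof -
    have "rpow Y Q (n + p) = T O rpow X R n O (E O S)"
      using Qpow[of "n + p"] that by (simp add: rpow_add[OF R] E_def O_assoc)
    then show ?thesis using Qpow[OF that] ES by simp
  qed
  have "canonical Y Q"
    using canonicalI[OF finY Q p per] reflexive anti Qp by simp
  moreover have "szym_isomorphic X R Y Q"
    using szym_isomorphicI[OF R Q homS homT] ST Qp E_def by metis
  moreover have "endo_obj Y Q" using finY Q by (simp add: endo_obj_def)
  ultimately show ?thesis by blast
qed

end
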